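(* Let $\alpha,\beta\geq 0$ be real numbers with $\alpha+\beta\neq 0$, and let $a,b\in\mathbb{R}$ with $a<b$, $b\in\{a+k\alpha: k\in\mathbb{N}_0\}$ and $a\in\{b-k\beta: k\in\mathbb{N}_0\}$. Let $f,g:\mathbb{R}\to\mathbb{R}$ be such that $|f|$ and $|g|$ are $\alpha,\beta$-symmetric integrable on $[a,b]$. Let $p>1$ and $q=p/(p-1)$. Then $$\int_{a}^{b}|f(t)g(t)|\,d_{\alpha,\beta}t\leq\left(\int_{a}^{b}|f(t)|^{p}\,d_{\alpha,\beta}t\right)^{1/p}\left(\int_{a}^{b}|g(t)|^{q}\,d_{\alpha,\beta}t\right)^{1/q}.$$
   Context: $\mathbb{N}_0=\{0,1,2,\dots\}$. Let $h:\mathbb{R}\to\mathbb{R}$ and $a<b$ be reals. For $\alpha>0$, $h$ is $\alpha$-forward integrable on $[a,b]$ if the series $\int_x^{+\infty}h(t)\Delta_\alpha t:=\alpha\sum_{k=0}^{+\infty}h(x+k\alpha)$ converges for $x=a$ and $x=b$; then $\int_a^b h(t)\Delta_\alpha t:=\int_a^{+\infty}h(t)\Delta_\alpha t-\int_b^{+\infty}h(t)\Delta_\alpha t$. For $\beta>0$, $h$ is $\beta$-backward integrable on $[a,b]$ if the series $\int_{-\infty}^x h(t)\nabla_\beta t:=\beta\sum_{k=0}^{+\infty}h(x-k\beta)$ converges for $x=a$ and $x=b$; then $\int_a^b h(t)\nabla_\beta t:=\int_{-\infty}^b h(t)\nabla_\beta t-\int_{-\infty}^a h(t)\nabla_\beta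 t$. For $\alpha,\beta\ge 0$ with $\alpha+\beta>0$, $h$ is $\alpha,\beta$-symmetric integrable on $[a,b]$ if it is $\alpha$-forward integrable and $\beta$-backward integrable on $[a,b]$ (the forward requirement is dropped if $\alpha=0$, and the backward requirement is dropped if $\beta=0$); then $$\int_a^b h(t)\,d_{\alpha,\beta}t:=\frac{\alpha}{\alpha+\beta}\int_a^b h(t)\Delta_\alpha t+\frac{\beta}{\alpha+\beta}\int_a^b h(t)\nabla_\beta t,$$ where a term with zero coefficient is omitted. *)

theory Defs
  imports Complex_Main
begin

definition forward_tail :: "real \<Rightarrow> (real \<Rightarrow> real) \<Rightarrow> real \<Rightarrow> real" where
  "forward_tail \<alpha> h x = \<alpha> * (\<Sum>k. h (x + real k * \<alpha>))"

definition forward_integrable :: "real \<Rightarrow> (real \<Rightarrow> real) \<Rightarrow> real \<Rightarrow> real \<Rightarrow> bool" where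
  "forward_integrable \<alpha> h a b \<longleftrightarrow>
     summable (\<lambda>k. h (a + real k * \<alpha>)) \<and> summable (\<lambda>k. h (b + real k * \<alpha>))"

definition forward_integral :: "real \<Rightarrow> (real \<Rightarrow> real) \<Rightarrow> real \<Rightarrow> real \<Rightarrow> real" where
  "forward_integral \<alpha> h a b = forward_tail \<alpha> h a - forward_tail \<alpha> h b"

definition backward_tail :: "real \<Rightarrow> (real \<Rightarrow> real) \<Rightarrow> real \<Rightarrow> real" where
  "backward_tail \<beta> h x = \<beta> * (\<Sum>k. h (x - real k * \<beta>))"

definition backward_integrable :: "real \<Rightarrow> (real \<Rightarrow> real) \<Rightarrow> real \<Rightarrow> real \<Rightarrow> bool" where
  "backward_integrable \<beta> h a b \<longleftrightarrow>
     summable (\<lambda>k. h (a - real k * \<beta>)) \<and> summable (\<lambda>k. h (b - real k * \<beta>))"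

definition backward_integral :: "real \<Rightarrow> (real \<Rightarrow> real) \<Rightarrow> real \<Rightarrow> real \<Rightarrow> real" where
  "backward_integral \<beta> h a b = backward_tail \<beta> h b - backward_tail \<beta> h a"

definition symmetric_integrable ::
    "real \<Rightarrow> real \<Rightarrow> (real \<Rightarrow> real) \<Rightarrow> real \<Rightarrow> real \<Rightarrow> bool" where
  "symmetric_integrable \<alpha> \<beta> h a b \<longleftrightarrow>
     (\<alpha> \<noteq> 0 \<longrightarrow> forward_integrable \<alpha> h a b) \<and>
     (\<beta> \<noteq> 0 \<longrightarrow> backward_integrable \<beta> h a b)"

(* When \<alpha> = 0 or \<beta> = 0 the corresponding one-sided integral is an unspecified real
   multiplied by 0, so that term vanishes: this is the usual convention of omitting it. *)
definition symmetric_integral ::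
    "real \<Rightarrow> real \<Rightarrow> (real \<Rightarrow> real) \<Rightarrow> real \<Rightarrow> real \<Rightarrow> real" where
  "symmetric_integral \<alpha> \<beta> h a b =
     \<alpha> / (\<alpha> + \<beta>) * forward_integral \<alpha> h a b +
     \<beta> / (\<alpha> + \<beta>) * backward_integral \<beta> h a b"

end

theory Submission
  imports Defs "HOL-Analysis.Convex"
begin

text \<open>
  Since \<open>a < b\<close>, the lattice conditions \<open>b = a + m\<alpha>\<close> and \<open>a = b - n\<beta>\<close> force \<open>\<alpha>\<close> and \<open>\<beta>\<close> to be
  positive, and they make the series defining the one-sided integrals telescope: the tail at \<open>b\<close>
  is the tail at \<open>a\<close> with its first \<open>m\<close> terms removed, and symmetrically for the backward tails.
  For integrable functions the symmetric integral is therefore a finite sum with nonnegative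
  weights over nodes that do not depend on the integrand
  (\<open>symmetric_integral_eq_weighted_sum\<close>), and the inequality is the
  weighted form of H\<ouml>lder's inequality for finite sums (\<open>weighted_Holder_sum\<close>).

  Integrability of \<open>\<bar>f g\<bar>\<close>, \<open>\<bar>f\<bar>\<^sup>p\<close> and \<open>\<bar>g\<bar>\<^sup>q\<close> comes from the fact that the terms of a convergent
  series are eventually at most \<open>1\<close>; from there on, the products and the powers are dominated by
  the terms of a series already known to converge (\<open>symmetric_integrable_dominated\<close>).
\<close>

text \<open>
  If one of the two power sums vanishes, every term on the left vanishes. Otherwise both factors
  are divided by their weighted norms, and Young's inequality, applied termwise and summed, bounds
  the normalised left-hand side by \<open>1/p + 1/q = 1\<close>.
\<close>

lemma weighted_Holder_sum:
  fixes w u v :: "'i \<Rightarrow> real" and p q :: real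
  assumes I: "finite I" and p: "p > 1" and q: "q > 1" and pq: "1 / p + 1 / q = 1"
    and w: "\<And>i. i \<in> I \<Longrightarrow> w i \<ge> 0"
    and u: "\<And>i. i \<in> I \<Longrightarrow> u i \<ge> 0"
    and v: "\<And>i. i \<in> I \<Longrightarrow> v i \<ge> 0"
  shows "(\<Sum>i\<in>I. w i * (u i * v i))
    \<le> (\<Sum>i\<in>I. w i * u i powr p) powr (1 / p) * (\<Sum>i\<in>I. w i * v i powr q) powr (1 / q)"
proof -
  define A where "A = (\<Sum>i\<in>I. w i * u i powr p)"
  define B where "B = (\<Sum>i\<in>I. w i * v i powr q)"
  have A0: "A \<ge> 0" and B0: "B \<ge> 0"
    unfolding A_def B_def using w by (auto intro!: sum_nonneg)
  show ?thesis
  proof (cases "A = 0 \<or> B = 0")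
    case True
    have "w i * (u i * v i) = 0" if i: "i \<in> I" for i
    proof -
      have "w i * u i powr p = 0 \<or> w i * v i powr q = 0"
        using True I i w unfolding A_def B_def
        by (subst (asm) (1 2) sum_nonneg_eq_0_iff) auto
      then show ?thesis by auto
    qed
    then have "(\<Sum>i\<in>I. w i * (u i * v i)) = 0" by (rule sum.neutral[OF ballI])
    then show ?thesis by simp
  next
    case False
    define s where "s = A powr (1 / p)"
    define t where "t = B powr (1 / q)"
    have A: "A > 0" and B: "B > 0" using False A0 B0 by auto
    have s: "s > 0" and t: "t > 0" using A B by (auto simp: s_def t_def)
    have sp: "s powr p = A" and tq: "t powr q = B"
      using A B p q by (auto simp: s_def t_def powr_powr)
    have "(\<Sum>i\<in>I. w i * (u i * v i)) / (s * t) = (\<Sum>i\<in>I. w i * ((u i / s) * (v i / t)))"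
      by (simp add: sum_divide_distrib)
    also have "\<dots> \<le> (\<Sum>i\<in>I. w i * ((u i / s) powr p / p + (v i / t) powr q / q))"
      using s t u v w by (intro sum_mono mult_left_mono Youngs_inequality[OF p q pq]) simp_all
    also have "\<dots> = (\<Sum>i\<in>I. w i * u i powr p / (A * p) + w i * v i powr q / (B * q))"
      using s t u v by (intro sum.cong refl) (simp add: powr_divide sp tq distrib_left)
    also have "\<dots> = A / (A * p) + B / (B * q)"
      by (simp add: sum.distrib A_def B_def flip: sum_divide_distrib)
    also have "\<dots> = 1" using A B pq by simp
    finally have "(\<Sum>i\<in>I. w i * (u i * v i)) \<le> s * t"
      using s t by (simp add: divide_le_eq)
    then show ?thesis unfolding s_def t_def A_def B_def .
  qed
qed

text \<open>
  The terms of a convergent series tend to \<open>0\<close>, so \<open>c\<close> is eventually at most \<open>1\<close>; it only serves to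
  restrict the comparison of \<open>k\<close> with \<open>h\<close> to the indices where \<open>c\<close> is small. Powers use this with
  \<open>c = h\<close>, products with \<open>c\<close> and \<open>h\<close> the two factors.
\<close>

lemma summable_dominated_where_small:
  fixes h c k :: "nat \<Rightarrow> real"
  assumes "summable h" and c: "summable c"
    and "\<And>n. 0 \<le> k n" and "\<And>n. c n \<le> 1 \<Longrightarrow> k n \<le> h n"
  shows "summable k"
proof (rule summable_comparison_test_ev)
  have "eventually (\<lambda>n. c n < 1) sequentially"
    using order_tendstoD(2)[OF summable_LIMSEQ_zero[OF c], of 1] by simp
  then show "eventually (\<lambda>n. norm (k n) \<le> h n) sequentially"
    by eventually_elim (use assms in auto)
qed fact

lemma symmetric_integrable_dominated:
  assumes "symmetric_integrable \<alpha> \<beta> h a b" and "symmetric_integrable \<alpha> \<beta> c a b"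
    and "\<And>t. 0 \<le> k t" and "\<And>t. c t \<le> 1 \<Longrightarrow> k t \<le> h t"
  shows "symmetric_integrable \<alpha> \<beta> k a b"
proof -
  have "summable (\<lambda>n. k (x n))" if "summable (\<lambda>n. h (x n))" "summable (\<lambda>n. c (x n))" for x
    by (rule summable_dominated_where_small[OF that]) (use assms in auto)
  from this[of "\<lambda>n. a + real n * \<alpha>"] this[of "\<lambda>n. b + real n * \<alpha>"]
    this[of "\<lambda>n. a - real n * \<beta>"] this[of "\<lambda>n. b - real n * \<beta>"]
  show ?thesis
    using assms(1,2)
    by (simp add: symmetric_integrable_def forward_integrable_def backward_integrable_def)
qed

lemma symmetric_integrable_abs_powr:
  assumes "symmetric_integrable \<alpha> \<beta> (\<lambda>t. \<bar>f t\<bar>) a b" and "r \<ge> 1"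
  shows "symmetric_integrable \<alpha> \<beta> (\<lambda>t. \<bar>f t\<bar> powr r) a b"
proof (rule symmetric_integrable_dominated[OF assms(1) assms(1)])
  show "\<bar>f t\<bar> powr r \<le> \<bar>f t\<bar>" if "\<bar>f t\<bar> \<le> 1" for t
    using powr_mono'[of 1 r "\<bar>f t\<bar>"] that assms(2) by simp
qed simp

lemma symmetric_integrable_abs_mult:
  assumes "symmetric_integrable \<alpha> \<beta> (\<lambda>t. \<bar>f t\<bar>) a b"
    and "symmetric_integrable \<alpha> \<beta> (\<lambda>t. \<bar>g t\<bar>) a b"
  shows "symmetric_integrable \<alpha> \<beta> (\<lambda>t. \<bar>f t * g t\<bar>) a b"
proof (rule symmetric_integrable_dominated[OF assms])
  show "\<bar>f t * g t\<bar> \<le> \<bar>f t\<bar>" if "\<bar>g t\<bar> \<le> 1" for t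
    using mult_left_mono[OF that, of "\<bar>f t\<bar>"] by (simp add: abs_mult)
qed simp

lemma forward_integral_eq_sum:
  assumes "forward_integrable \<alpha> h a b" and b: "b = a + real m * \<alpha>"
  shows "forward_integral \<alpha> h a b = \<alpha> * (\<Sum>i<m. h (a + real i * \<alpha>))"
proof -
  have "h (b + real k * \<alpha>) = h (a + real (k + m) * \<alpha>)" for k
    by (simp add: b algebra_simps)
  moreover have "(\<Sum>k. h (a + real k * \<alpha>)) =
      (\<Sum>k. h (a + real (k + m) * \<alpha>)) + (\<Sum>i<m. h (a + real i * \<alpha>))"
    using assms(1) by (intro suminf_split_initial_segment) (simp add: forward_integrable_def)
  ultimately show ?thesis
    by (simp add: forward_integral_def forward_tail_def algebra_simps)
qed

text \<open>Reflecting the line at the origin exchanges forward and backward integrals.\<close>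

lemma backward_integral_eq_sum:
  assumes "backward_integrable \<beta> h a b" and a: "a = b - real n * \<beta>"
  shows "backward_integral \<beta> h a b = \<beta> * (\<Sum>i<n. h (b - real i * \<beta>))"
proof -
  have "forward_integrable \<beta> (\<lambda>t. h (- t)) (- b) (- a)"
    using assms(1) by (simp add: forward_integrable_def backward_integrable_def)
  then have "forward_integral \<beta> (\<lambda>t. h (- t)) (- b) (- a) = \<beta> * (\<Sum>i<n. h (b - real i * \<beta>))"
    using forward_integral_eq_sum[of \<beta> "\<lambda>t. h (- t)" "- b" "- a" n] a by simp
  then show ?thesis
    by (simp add: forward_integral_def backward_integral_def forward_tail_def backward_tail_def)
qed

text \<open>
  The forward and the backward nodes are indexed separately, by a disjoint sum: a point that occurs
  on both lattices simply contributes twice. The weights are squared steps over \<open>\<alpha> + \<beta>\<close>, one factor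
  being the mesh of the series and the other the coefficient of the one-sided integral.
\<close>

lemma symmetric_integral_eq_weighted_sum:
  fixes \<alpha> \<beta> a b :: real and m n :: nat
  assumes "\<alpha> > 0" and "\<beta> > 0" and "b = a + real m * \<alpha>" and "a = b - real n * \<beta>"
  obtains w x :: "nat + nat \<Rightarrow> real" and I :: "(nat + nat) set"
  where "finite I" and "\<And>i. w i \<ge> 0"
    and "\<And>h. symmetric_integrable \<alpha> \<beta> h a b \<Longrightarrow>
      symmetric_integral \<alpha> \<beta> h a b = (\<Sum>i\<in>I. w i * h (x i))"
proof
  let ?I = "{..<m} <+> {..<n}"
  let ?w = "case_sum (\<lambda>_. \<alpha>\<^sup>2 / (\<alpha> + \<beta>)) (\<lambda>_. \<beta>\<^sup>2 / (\<alpha> + \<beta>)) :: nat + nat \<Rightarrow> real"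
  let ?x = "case_sum (\<lambda>i. a + real i * \<alpha>) (\<lambda>i. b - real i * \<beta>)"
  show "finite ?I" by simp
  show "?w i \<ge> 0" for i using assms(1,2) by (cases i) auto
  show "symmetric_integral \<alpha> \<beta> h a b = (\<Sum>i\<in>?I. ?w i * h (?x i))"
    if "symmetric_integrable \<alpha> \<beta> h a b" for h
  proof -
    have F: "forward_integrable \<alpha> h a b" and B: "backward_integrable \<beta> h a b"
      using that assms(1,2) by (auto simp: symmetric_integrable_def)
    show ?thesis
      unfolding symmetric_integral_def
        forward_integral_eq_sum[OF F assms(3)] backward_integral_eq_sum[OF B assms(4)]
      by (simp add: sum.Plus power2_eq_square sum_distrib_left sum_divide_distrib mult.assoc)
  qed
qed

theorem theorem10:
  fixes \<alpha> \<beta> a b p q :: real and f g :: "real \<Rightarrow> real"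
  assumes "\<alpha> \<ge> 0" and "\<beta> \<ge> 0" and "\<alpha> + \<beta> \<noteq> 0"
    and "a < b"
    and "b \<in> {a + real k * \<alpha> | k :: nat. True}"
    and "a \<in> {b - real k * \<beta> | k :: nat. True}"
    and "symmetric_integrable \<alpha> \<beta> (\<lambda>t. \<bar>f t\<bar>) a b"
    and "symmetric_integrable \<alpha> \<beta> (\<lambda>t. \<bar>g t\<bar>) a b"
    and "p > 1" and "q = p / (p - 1)"
  shows "symmetric_integrable \<alpha> \<beta> (\<lambda>t. \<bar>f t * g t\<bar>) a b \<and>
    symmetric_integrable \<alpha> \<beta> (\<lambda>t. \<bar>f t\<bar> powr p) a b \<and>
    symmetric_integrable \<alpha> \<beta> (\<lambda>t. \<bar>g t\<bar> powr q) a b \<and>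
    symmetric_integral \<alpha> \<beta> (\<lambda>t. \<bar>f t * g t\<bar>) a b
      \<le> symmetric_integral \<alpha> \<beta> (\<lambda>t. \<bar>f t\<bar> powr p) a b powr (1 / p)
        * symmetric_integral \<alpha> \<beta> (\<lambda>t. \<bar>g t\<bar> powr q) a b powr (1 / q)"
proof -
  obtain m where m: "b = a + real m * \<alpha>" using assms(5) by auto
  obtain n where n: "a = b - real n * \<beta>" using assms(6) by auto
  have "\<alpha> \<noteq> 0" using m \<open>a < b\<close> by auto
  then have \<alpha>: "\<alpha> > 0" using assms(1) by simp
  have "\<beta> \<noteq> 0" using n \<open>a < b\<close> by auto
  then have \<beta>: "\<beta> > 0" using assms(2) by simp
  have q: "q > 1" and pq: "1 / p + 1 / q = 1"
    using assms(9) by (simp_all add: assms(10) field_simps)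
  have fg: "symmetric_integrable \<alpha> \<beta> (\<lambda>t. \<bar>f t * g t\<bar>) a b"
    using symmetric_integrable_abs_mult[OF assms(7,8)] .
  have fp: "symmetric_integrable \<alpha> \<beta> (\<lambda>t. \<bar>f t\<bar> powr p) a b"
    using symmetric_integrable_abs_powr[OF assms(7)] assms(9) by simp
  have gq: "symmetric_integrable \<alpha> \<beta> (\<lambda>t. \<bar>g t\<bar> powr q) a b"
    using symmetric_integrable_abs_powr[OF assms(8)] q by simp
  obtain w x :: "nat + nat \<Rightarrow> real" and I where
    I: "finite I" and w: "\<And>i. w i \<ge> 0" and
    integral: "\<And>h. symmetric_integrable \<alpha> \<beta> h a b \<Longrightarrow>
      symmetric_integral \<alpha> \<beta> h a b = (\<Sum>i\<in>I. w i * h (x i))"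
    using symmetric_integral_eq_weighted_sum[OF \<alpha> \<beta> m n] by metis
  have "(\<Sum>i\<in>I. w i * \<bar>f (x i) * g (x i)\<bar>)
      \<le> (\<Sum>i\<in>I. w i * \<bar>f (x i)\<bar> powr p) powr (1 / p)
        * (\<Sum>i\<in>I. w i * \<bar>g (x i)\<bar> powr q) powr (1 / q)"
    using weighted_Holder_sum[OF I assms(9) q pq, of w "\<lambda>i. \<bar>f (x i)\<bar>" "\<lambda>i. \<bar>g (x i)\<bar>"] w
    by (simp add: abs_mult)
  then show ?thesis
    using fg fp gq by (simp add: integral)
qed

end
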